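(* Let $(G_N)_{N\ge1}$ be a sequence of 2-regular configuration models $\mathrm{CM}_N(\mathbf 2)$. Then, for all $\beta>0$ and $B\in\mathbb R$, the following hold. (i) The annealed pressure exists in the thermodynamic limit $N\to\infty$ and is given by $$\widetilde\psi(\beta,B):=\lim_{N\to\infty}\widetilde\psi_N(\beta,B)=\log\lambda_+(\beta,B),\qquad \lambda_+(\beta,B)=e^{\beta}\Big[\cosh(B)+\sqrt{\sinh^2(B)+e^{-4\beta}}\Big].$$ (ii) The magnetization per vertex exists in the limit $N\to\infty$ and is given by $$\widetilde M(\beta,B):=\lim_{N\to\infty}\widetilde M_N(\beta,B)=\frac{\sinh(B)}{\sqrt{\sinh^2(B)+e^{-4\beta}}}.$$
   Context: Configuration model: given degrees $(d_i)_{i\in[N]}$ with even sum, attach $d_i$ half-edges to vertex $i\in[N]=\{1,\dots,N\}$ and pair all half-edges uniformly at random; each pair forms an edge, giving a random multigraph (self-loops and multiple edges allowed). $\mathrm{CM}_N(\mathbf 2)$ is the case $d_i=2$ for all $i\in[N]$. Annealed Ising model: let $Q_N$ denote the law of the random multigraph $G_N=([N],E_N)$ and also the corresponding expectation; $E_N$ is counted with multiplicity, and a self-loop at $i$ contributes a term $\sigma_i\sigma_i=1$ once. For $\beta\ge0$, $B\in\mathbb R$ the annealed measure on $\sigma\in\{-1,1\}^N$ is $$\widetilde P_N(\sigma)=\frac{Q_N\big(\exp[\beta\sum_{(i,j)\in E_N}\sigma_i\sigma_j+B\sum_{i\in[N]}\sigma_i]\big)}{Q_N(Z_N(\beta,B))},\qquad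 Z_N(\beta,B)=\sum_{\sigma\in\{-1,1\}^N}\exp\Big[\beta\sum_{(i,j)\in E_N}\sigma_i\sigma_j+B\sum_{i\in[N]}\sigma_i\Big].$$ $\widetilde P_N(\cdot)$ also denotes expectation. $S_N=\sum_{i\in[N]}\sigma_i$; $\widetilde\psi_N(\beta,B)=\frac1N\log Q_N(Z_N(\beta,B))$; $\widetilde M_N(\beta,B)=\widetilde P_N(S_N/N)$. *)

theory Defs
  imports "HOL-Probability.Probability"
begin

text \<open>
  A multigraph on the vertex set \<open>{1..N}\<close> is represented by its multiset of edges; an edge is the
  multiset of its two endpoints, so \<open>{#i, i#}\<close> is a self-loop at \<open>i\<close>.
\<close>

type_synonym edges = "nat multiset multiset"

definition half_edges :: "nat \<Rightarrow> (nat \<Rightarrow> nat) \<Rightarrow> (nat \<times> nat) set" where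
  "half_edges N d = (SIGMA i:{1..N}. {..<d i})"

definition pairings :: "'a set \<Rightarrow> 'a set set set" where
  "pairings H = {M. partition_on H M \<and> (\<forall>p\<in>M. card p = 2)}"

text \<open>
  Projecting the half-edges \<open>(i, k)\<close> and \<open>(j, l)\<close> of a pair to their vertices gives the edge
  \<open>{#i, j#}\<close>; multiplicities are kept both within an edge and between edges.
\<close>

definition edges_of_pairing :: "(nat \<times> nat) set set \<Rightarrow> edges" where
  "edges_of_pairing M = image_mset (\<lambda>p. image_mset fst (mset_set p)) (mset_set M)"

text \<open>
  The law of the configuration model is meaningful only if the sum of the degrees is even;
  otherwise there is no pairing and \<^const>\<open>pmf_of_set\<close> is unspecified.
\<close>

definition configuration_model :: "nat \<Rightarrow> (nat \<Rightarrow> nat) \<Rightarrow> edges pmf" where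
  "configuration_model N d = map_pmf edges_of_pairing (pmf_of_set (pairings (half_edges N d)))"

lemma finite_half_edges: "finite (half_edges N d)"
  by (simp add: half_edges_def)

lemma card_half_edges: "card (half_edges N d) = (\<Sum>i\<in>{1..N}. d i)"
  by (simp add: half_edges_def)

lemma finite_pairings:
  assumes "finite H"
  shows "finite (pairings H)"
proof -
  have "pairings H \<subseteq> Pow (Pow H)"
    by (auto simp: pairings_def partition_on_def)
  then show ?thesis
    using assms by (meson finite_Pow_iff finite_subset)
qed

lemma pairings_nonempty:
  assumes "finite H" "even (card H)"
  shows "pairings H \<noteq> {}"
  using assms
proof (induction "card H" arbitrary: H rule: less_induct)
  case less
  show ?case
  proof (cases "H = {}")
    case True
    then show ?thesis
      by (auto simp: pairings_def partition_on_def intro!: exI[of _ "{}"])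
  next
    case False
    then have "card H \<noteq> 0"
      using less.prems by simp
    then have "2 \<le> card H"
      using less.prems by presburger
    then obtain p where p: "p \<subseteq> H" "card p = 2"
      by (meson obtain_subset_with_card_n)
    have fp: "finite p"
      using p less.prems finite_subset by blast
    have c: "card (H - p) = card H - 2"
      using p fp by (simp add: card_Diff_subset)
    have "pairings (H - p) \<noteq> {}"
      using \<open>2 \<le> card H\<close> less.prems c by (intro less.hyps) auto
    then obtain M where M: "partition_on (H - p) M" "\<forall>q\<in>M. card q = 2"
      by (auto simp: pairings_def)
    have "p \<noteq> {}"
      using p by auto
    moreover have "disjnt (\<Union>M) p"
      using partition_onD1[OF M(1)] by (auto simp: disjnt_def)
    ultimately have "partition_on H (insert p M)"
      using M(1) p(1)
      by (auto simp: partition_on_def disjoint_def disjnt_def)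
    then have "insert p M \<in> pairings H"
      using M(2) p(2) by (simp add: pairings_def)
    then show ?thesis by blast
  qed
qed

definition spins :: "nat \<Rightarrow> (nat \<Rightarrow> real) set" where
  "spins N = ({1..N} \<rightarrow>\<^sub>E {-1, 1})"

definition total_spin :: "nat \<Rightarrow> (nat \<Rightarrow> real) \<Rightarrow> real" where
  "total_spin N \<sigma> = (\<Sum>i\<in>{1..N}. \<sigma> i)"

text \<open>The factor \<open>\<Prod>i\<in>#e. \<sigma> i\<close> is \<open>\<sigma> i * \<sigma> j\<close> for the edge \<open>e = {#i, j#}\<close>, also when \<open>i = j\<close>.\<close>

definition boltzmann_weight ::
  "nat \<Rightarrow> edges \<Rightarrow> real \<Rightarrow> real \<Rightarrow> (nat \<Rightarrow> real) \<Rightarrow> real" where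
  "boltzmann_weight N E \<beta> B \<sigma> =
     exp (\<beta> * (\<Sum>e\<in>#E. \<Prod>i\<in>#e. \<sigma> i) + B * total_spin N \<sigma>)"

definition partition_function :: "nat \<Rightarrow> edges \<Rightarrow> real \<Rightarrow> real \<Rightarrow> real" where
  "partition_function N E \<beta> B = (\<Sum>\<sigma>\<in>spins N. boltzmann_weight N E \<beta> B \<sigma>)"

text \<open>In the annealed quantities, \<open>Q\<close> is the law of the random multigraph on \<open>{1..N}\<close>.\<close>

definition annealed_measure ::
  "edges pmf \<Rightarrow> nat \<Rightarrow> real \<Rightarrow> real \<Rightarrow> (nat \<Rightarrow> real) \<Rightarrow> real" where
  "annealed_measure Q N \<beta> B \<sigma> =
     measure_pmf.expectation Q (\<lambda>E. boltzmann_weight N E \<beta> B \<sigma>) /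
     measure_pmf.expectation Q (\<lambda>E. partition_function N E \<beta> B)"

definition annealed_expectation ::
  "edges pmf \<Rightarrow> nat \<Rightarrow> real \<Rightarrow> real \<Rightarrow> ((nat \<Rightarrow> real) \<Rightarrow> real) \<Rightarrow> real" where
  "annealed_expectation Q N \<beta> B f = (\<Sum>\<sigma>\<in>spins N. f \<sigma> * annealed_measure Q N \<beta> B \<sigma>)"

definition annealed_pressure :: "edges pmf \<Rightarrow> nat \<Rightarrow> real \<Rightarrow> real \<Rightarrow> real" where
  "annealed_pressure Q N \<beta> B =
     1 / real N * ln (measure_pmf.expectation Q (\<lambda>E. partition_function N E \<beta> B))"

definition annealed_magnetization :: "edges pmf \<Rightarrow> nat \<Rightarrow> real \<Rightarrow> real \<Rightarrow> real" where
  "annealed_magnetization Q N \<beta> B =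
     annealed_expectation Q N \<beta> B (\<lambda>\<sigma>. total_spin N \<sigma> / real N)"

definition lambda_plus :: "real \<Rightarrow> real \<Rightarrow> real" where
  "lambda_plus \<beta> B = exp \<beta> * (cosh B + sqrt ((sinh B)\<^sup>2 + exp (- 4 * \<beta>)))"

end

theory Submission
  imports Defs
begin

text \<open>
  Uniform pairings obey a Wick formula, and for Ising weights the underlying Gaussian integral can
  be reduced to an integral over a circle. If every half-edge \<open>h\<close> carries an angle \<open>\<phi> h\<close>, then summing
  over all pairings the product of the factors \<open>cos (\<phi> h - \<phi> k)\<close> of the pairs \<open>{h, k}\<close> gives a
  constant multiple of \<open>\<integral> (\<Prod>h. cos (t - \<phi> h)) dt\<close> over a period (\<open>sum_pairings_cos\<close>): both sides
  satisfy the recursion that removes a fixed half-edge together with its partner, the right-hand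
  side through integration by parts. Behind this are the moments of the linear forms
  \<open>X cos (\<phi> h) + Y sin (\<phi> h)\<close> of two independent standard Gaussians \<open>X\<close>, \<open>Y\<close>, whose radial part
  contributes only the constant.

  Since \<open>\<beta> \<ge> 0\<close>, an angle \<open>\<phi>\<close> with \<open>cos (2 * \<phi>) = exp (- 2 * \<beta>)\<close> exists, and then
  \<open>exp (\<beta> * s * s') = exp \<beta> * cos (s * \<phi> - s' * \<phi>)\<close> for spins \<open>s, s' = \<plusminus>1\<close>. So the half-edges at a vertex
  of spin \<open>s\<close> get the angle \<open>s * \<phi>\<close>. For fixed \<open>t\<close> the integrand factorises over the vertices, each
  of which contributes \<open>exp (B * s) * (cos (t - s * \<phi>))\<^sup>2\<close>, and the sum over all spin configurations
  is an \<open>N\<close>-th power. Dividing by the number of pairings, which is the same integral with all angles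
  zero, gives
  \<open>Q\<^sub>N(Z\<^sub>N) = exp \<beta> ^ N * (\<integral> F ^ N) / (\<integral> (cos\<^sup>2) ^ N)\<close> with
  \<open>F t = exp B * (cos (t - \<phi>))\<^sup>2 + exp (- B) * (cos (t + \<phi>))\<^sup>2\<close>
  (\<open>expectation_partition_function_CM_2\<close>).

  By Laplace's principle the integral of the \<open>N\<close>-th power of a function grows at the exponential
  rate of its maximum (\<open>ln_integral_power_tendsto\<close>). The maximum of \<open>F\<close> is
  \<open>cosh B + sqrt ((sinh B)\<^sup>2 + exp (- 4 * \<beta>))\<close>, that of \<open>cos\<^sup>2\<close> is \<open>1\<close>, and the pressure follows.

  For the magnetization, the annealed pressure is a convex function of \<open>B\<close> of which the magnetization
  is a subgradient (\<open>annealed_pressure_subgradient\<close>). Subgradients of convergent functions converge to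
  the derivative of the limit wherever it exists (\<open>subgradient_tendsto_derivative\<close>), and the
  derivative of \<open>ln \<lambda>\<^sub>+\<close> in \<open>B\<close> is the claimed limit.
\<close>

section \<open>Sums over pairings\<close>

text \<open>
  Both directions are needed for the bijection between the pairings of \<open>H\<close> that match \<open>h\<close> with \<open>h'\<close>
  and the pairings of the remaining points.
\<close>

lemma insert_pair_pairings:
  assumes "h \<in> H" "h' \<in> H" "h \<noteq> h'"
  shows "{h, h'} \<notin> M \<and> insert {h, h'} M \<in> pairings H \<longleftrightarrow> M \<in> pairings (H - {h, h'})"
proof -
  have "{h, h'} \<notin> M \<and> partition_on H (insert {h, h'} M) \<longleftrightarrow> partition_on (H - {h, h'}) M"
  proof (cases "disjnt {h, h'} (\<Union>M)")
    case True
    then have "{h, h'} \<notin> M"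
      by (auto simp: disjnt_def)
    with assms show ?thesis
      by (simp add: partition_on_insert[OF True])
  next
    case False
    then have "\<not> partition_on (H - {h, h'}) M"
      using partition_onD1[of "H - {h, h'}" M] by (auto simp: disjnt_def)
    moreover have "{h, h'} \<in> M" if "partition_on H (insert {h, h'} M)"
      using partition_onD2[OF that] False by (auto simp: pairwise_insert disjnt_def)
    ultimately show ?thesis by metis
  qed
  moreover have "card {h, h'} = 2"
    using assms by simp
  ultimately show ?thesis
    by (auto simp: pairings_def)
qed

lemma pairing_partner:
  assumes "M \<in> pairings H" "h \<in> H"
  obtains h' where "h' \<in> H - {h}" "{h, h'} \<in> M"
proof -
  have part: "partition_on H M" and two: "\<forall>p\<in>M. card p = 2"
    using assms(1) by (auto simp: pairings_def)
  from part assms(2) obtain p where p: "p \<in> M" "h \<in> p" "p \<subseteq> H"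
    by (auto simp: partition_on_def)
  from two p(1) obtain a b where "p = {a, b}" "a \<noteq> b"
    by (auto simp: card_2_iff)
  then show thesis
  proof (cases "h = a")
    case True
    with \<open>p = {a, b}\<close> \<open>a \<noteq> b\<close> p show thesis
      by (intro that[of b]) auto
  next
    case False
    with \<open>p = {a, b}\<close> p have "p = {h, a}" "h = b" by auto
    with \<open>a \<noteq> b\<close> \<open>p = {a, b}\<close> p show thesis
      by (intro that[of a]) auto
  qed
qed

text \<open>
  Classify the pairings by the partner of the fixed point \<open>h\<close>.
\<close>

lemma sum_pairings_rec:
  fixes w :: "'a set \<Rightarrow> 'b::comm_semiring_1"
  assumes fin: "finite H" and h: "h \<in> H"
  shows "(\<Sum>M\<in>pairings H. \<Prod>p\<in>M. w p) =
    (\<Sum>h'\<in>H - {h}. w {h, h'} * (\<Sum>M\<in>pairings (H - {h, h'}). \<Prod>p\<in>M. w p))"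
proof -
  let ?S = "SIGMA h':H - {h}. pairings (H - {h, h'})"
  let ?i = "\<lambda>(h', M). insert {h, h'} M"
  have "bij_betw ?i ?S (pairings H)"
  proof (rule bij_betw_imageI)
    show "inj_on ?i ?S"
    proof (rule inj_onI)
      fix x y assume x: "x \<in> ?S" and y: "y \<in> ?S" and xy: "?i x = ?i y"
      obtain a M where a: "x = (a, M)" "a \<in> H - {h}" "M \<in> pairings (H - {h, a})"
        using x by (elim SigmaE)
      obtain b N where b: "y = (b, N)" "b \<in> H - {h}" "N \<in> pairings (H - {h, b})"
        using y by (elim SigmaE)
      have eq: "insert {h, a} M = insert {h, b} N"
        using xy a(1) b(1) by simp
      \<comment> \<open>No pair of \<open>M\<close> or \<open>N\<close> contains \<open>h\<close>, so the common image has only one pair that does.\<close>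
      have M: "p \<notin> M" and N: "p \<notin> N" if "h \<in> p" for p
        using a(3) b(3) that unfolding pairings_def partition_on_def by blast+
      have "{h, b} \<in> insert {h, a} M"
        unfolding eq by simp
      with M[of "{h, b}"] have "{h, b} = {h, a}"
        by simp
      then have ab: "a = b"
        unfolding doubleton_eq_iff by metis
      have "M = insert {h, a} M - {{h, a}}"
        using M[of "{h, a}"] by simp
      also have "\<dots> = N"
        unfolding eq using N[of "{h, b}"] ab by simp
      finally show "x = y"
        using a(1) b(1) ab by simp
    qed
    show "?i ` ?S = pairings H"
    proof (intro equalityI subsetI)
      fix M assume "M \<in> ?i ` ?S"
      then obtain h' N where "h' \<in> H" "h \<noteq> h'" "N \<in> pairings (H - {h, h'})" "M = insert {h, h'} N"
        by auto
      then show "M \<in> pairings H"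
        using insert_pair_pairings[OF h, of h' N] by metis
    next
      fix M assume M: "M \<in> pairings H"
      then obtain h' where h': "h' \<in> H - {h}" "{h, h'} \<in> M"
        using h by (rule pairing_partner)
      have eq: "insert {h, h'} (M - {{h, h'}}) = M"
        using h'(2) by (rule insert_Diff)
      have "M - {{h, h'}} \<in> pairings (H - {h, h'})"
        using insert_pair_pairings[OF h, of h' "M - {{h, h'}}"] h' M unfolding eq by auto
      then have mem: "(h', M - {{h, h'}}) \<in> ?S"
        using h' by blast
      show "M \<in> ?i ` ?S"
        by (rule image_eqI[OF _ mem]) (simp only: prod.case eq)
    qed
  qed
  then have "(\<Sum>M\<in>pairings H. \<Prod>p\<in>M. w p) = (\<Sum>x\<in>?S. \<Prod>p\<in>?i x. w p)"
    by (rule sum.reindex_bij_betw[symmetric])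
  also have "\<dots> = (\<Sum>(h', M)\<in>?S. w {h, h'} * (\<Prod>p\<in>M. w p))"
  proof (rule sum.cong[OF refl])
    fix x assume "x \<in> ?S"
    then obtain h' M where x: "x = (h', M)" and h': "h' \<in> H - {h}"
      and M: "M \<in> pairings (H - {h, h'})"
      by (elim SigmaE)
    from M have "finite M"
      using fin finite_elements[of "H - {h, h'}" M] by (auto simp: pairings_def)
    moreover have "{h, h'} \<notin> M"
      using insert_pair_pairings[OF h, of h' M] h' M by blast
    ultimately show "(\<Prod>p\<in>?i x. w p) = (case x of (h', M) \<Rightarrow> w {h, h'} * (\<Prod>p\<in>M. w p))"
      by (simp add: x)
  qed
  also have "\<dots> = (\<Sum>h'\<in>H - {h}. w {h, h'} * (\<Sum>M\<in>pairings (H - {h, h'}). \<Prod>p\<in>M. w p))"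
    using fin by (subst sum.Sigma[symmetric]) (auto simp: finite_pairings sum_distrib_left)
  finally show ?thesis .
qed

section \<open>A Wick formula on the circle\<close>

text \<open>
  Integration by parts: the left-hand side minus the right-hand side is the integral over a period
  of the derivative of \<open>sin (t - \<phi> h) * (\<Prod>k\<in>H - {h}. cos (t - \<phi> k))\<close>. The identity
  \<open>sin (t - \<phi> h) * sin (t - \<phi> k) = cos (\<phi> h - \<phi> k) - cos (t - \<phi> h) * cos (t - \<phi> k)\<close> turns each term
  in which \<open>cos (t - \<phi> k)\<close> is differentiated into a term of the right-hand side and one copy of the
  full product.
\<close>

lemma integral_prod_cos_rec:
  fixes \<phi> :: "'a \<Rightarrow> real"
  assumes fin: "finite H" and h: "h \<in> H"
  shows "real (card H) * integral {0..2*pi} (\<lambda>t. \<Prod>k\<in>H. cos (t - \<phi> k)) =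
    (\<Sum>k\<in>H - {h}. cos (\<phi> h - \<phi> k) *
       integral {0..2*pi} (\<lambda>t. \<Prod>l\<in>H - {h, k}. cos (t - \<phi> l)))"
proof -
  define g where "g t = (\<Sum>k\<in>H - {h}. cos (\<phi> h - \<phi> k) * (\<Prod>l\<in>H - {h, k}. cos (t - \<phi> l)))
      - real (card H) * (\<Prod>k\<in>H. cos (t - \<phi> k))" for t
  define G where "G t = - sin (t - \<phi> h) * (\<Prod>k\<in>H - {h}. cos (t - \<phi> k))" for t
  have "(G has_real_derivative g t) (at t)" for t
  proof -
    have rest: "(\<Prod>k\<in>H. cos (t - \<phi> k)) =
        cos (t - \<phi> h) * (cos (t - \<phi> k) * (\<Prod>l\<in>H - {h, k}. cos (t - \<phi> l)))"
      if "k \<in> H - {h}" for k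
    proof -
      have "H - {h} - {k} = H - {h, k}" by auto
      then show ?thesis
        using fin h that prod.remove[of H h "\<lambda>k. cos (t - \<phi> k)"]
          prod.remove[of "H - {h}" k "\<lambda>k. cos (t - \<phi> k)"] by simp
    qed
    have "(\<Sum>k\<in>H - {h}. sin (t - \<phi> h) * sin (t - \<phi> k) * (\<Prod>l\<in>H - {h, k}. cos (t - \<phi> l)))
       = (\<Sum>k\<in>H - {h}. cos (\<phi> h - \<phi> k) * (\<Prod>l\<in>H - {h, k}. cos (t - \<phi> l))
            - (\<Prod>k\<in>H. cos (t - \<phi> k)))"
    proof (rule sum.cong[OF refl])
      fix k assume k: "k \<in> H - {h}"
      have "sin (t - \<phi> h) * sin (t - \<phi> k) =
          cos (\<phi> h - \<phi> k) - cos (t - \<phi> h) * cos (t - \<phi> k)"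
        using cos_diff[of "t - \<phi> k" "t - \<phi> h"] by simp
      then show "sin (t - \<phi> h) * sin (t - \<phi> k) * (\<Prod>l\<in>H - {h, k}. cos (t - \<phi> l)) =
          cos (\<phi> h - \<phi> k) * (\<Prod>l\<in>H - {h, k}. cos (t - \<phi> l)) - (\<Prod>k\<in>H. cos (t - \<phi> k))"
        by (simp add: rest[OF k] left_diff_distrib)
    qed
    also have "\<dots> = g t + (\<Prod>k\<in>H. cos (t - \<phi> k))"
      using fin h card_gt_0_iff[of H]
      by (auto simp: g_def sum_subtractf card_Diff_singleton of_nat_diff algebra_simps)
    finally have g: "g t = (\<Sum>k\<in>H - {h}. sin (t - \<phi> h) * sin (t - \<phi> k) *
        (\<Prod>l\<in>H - {h, k}. cos (t - \<phi> l))) - (\<Prod>k\<in>H. cos (t - \<phi> k))"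
      by simp
    have "(G has_real_derivative - cos (t - \<phi> h) * (\<Prod>k\<in>H - {h}. cos (t - \<phi> k))
        + (\<Sum>k\<in>H - {h}. - sin (t - \<phi> k) * (\<Prod>l\<in>H - {h} - {k}. cos (t - \<phi> l)))
          * - sin (t - \<phi> h)) (at t)"
      unfolding G_def
      by (intro DERIV_mult has_field_derivative_prod) (auto intro!: derivative_eq_intros)
    moreover have "- cos (t - \<phi> h) * (\<Prod>k\<in>H - {h}. cos (t - \<phi> k))
        + (\<Sum>k\<in>H - {h}. - sin (t - \<phi> k) * (\<Prod>l\<in>H - {h} - {k}. cos (t - \<phi> l)))
          * - sin (t - \<phi> h) = g t"
      unfolding g prod.remove[OF fin h] Diff_insert2[of H h "{_}"]
      by (simp add: sum_distrib_left mult_ac)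
    ultimately show ?thesis by simp
  qed
  then have "(g has_integral (G (2 * pi) - G 0)) {0..2*pi}"
    by (intro fundamental_theorem_of_calculus)
       (auto simp: has_real_derivative_iff_has_vector_derivative
          intro: has_vector_derivative_at_within)
  moreover have "G (2 * pi) = G 0"
    by (simp add: G_def sin_diff cos_diff)
  ultimately have "integral {0..2*pi} g = 0"
    by (simp add: integral_unique)
  moreover have "integral {0..2*pi} g =
      (\<Sum>k\<in>H - {h}. cos (\<phi> h - \<phi> k) *
         integral {0..2*pi} (\<lambda>t. \<Prod>l\<in>H - {h, k}. cos (t - \<phi> l)))
      - real (card H) * integral {0..2*pi} (\<lambda>t. \<Prod>k\<in>H. cos (t - \<phi> k))"
  proof -
    have int: "(\<lambda>t. c * (\<Prod>k\<in>K. cos (t - \<phi> k))) integrable_on {0..2*pi}" for c K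
      by (intro integrable_continuous_real continuous_intros)
    show ?thesis
      using fin unfolding g_def
      by (simp add: integral_diff integral_sum int integrable_sum)
  qed
  ultimately show ?thesis by simp
qed

text \<open>
  Both recursions above have the same shape, except that \<open>integral_prod_cos_rec\<close> carries the number
  of points on its left-hand side. Splitting off a pair from \<open>2 * n\<close> points therefore contributes
  \<open>2 * n\<close>, and \<open>c\<close> from the weight of the pair, to the constant; \<open>2 * pi\<close> is the integral of the empty
  product.
\<close>

lemma sum_pairings_cos:
  fixes \<phi> :: "'a \<Rightarrow> real" and c :: real
  assumes "finite H" "card H = 2 * n"
    and "\<And>h k. h \<in> H \<Longrightarrow> k \<in> H \<Longrightarrow> h \<noteq> k \<Longrightarrow> w {h, k} = c * cos (\<phi> h - \<phi> k)"
  shows "(\<Sum>M\<in>pairings H. \<Prod>p\<in>M. w p) =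
    (2 * c) ^ n * fact n / (2 * pi) * integral {0..2*pi} (\<lambda>t. \<Prod>h\<in>H. cos (t - \<phi> h))"
  using assms
proof (induction n arbitrary: H)
  case 0
  then have "H = {}" by simp
  moreover have "pairings ({} :: 'a set) = {{}}"
    by (auto simp: pairings_def partition_on_empty)
  ultimately show ?case by simp
next
  case (Suc n)
  then obtain h where h: "h \<in> H" by fastforce
  let ?I = "\<lambda>H. integral {0..2*pi} (\<lambda>t. \<Prod>h\<in>H. cos (t - \<phi> h))"
  have "(\<Sum>M\<in>pairings H. \<Prod>p\<in>M. w p) =
      (\<Sum>k\<in>H - {h}. w {h, k} * (\<Sum>M\<in>pairings (H - {h, k}). \<Prod>p\<in>M. w p))"
    using Suc.prems(1) h by (rule sum_pairings_rec)
  also have "\<dots> = (\<Sum>k\<in>H - {h}. c * cos (\<phi> h - \<phi> k) *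
      ((2 * c) ^ n * fact n / (2 * pi) * ?I (H - {h, k})))"
  proof (rule sum.cong[OF refl])
    fix k assume k: "k \<in> H - {h}"
    have "card (H - {h, k}) = 2 * n"
      using Suc.prems(1,2) h k by (subst card_Diff_subset) auto
    then have "(\<Sum>M\<in>pairings (H - {h, k}). \<Prod>p\<in>M. w p) =
        (2 * c) ^ n * fact n / (2 * pi) * ?I (H - {h, k})"
      using Suc.prems by (intro Suc.IH) auto
    then show "w {h, k} * (\<Sum>M\<in>pairings (H - {h, k}). \<Prod>p\<in>M. w p) =
        c * cos (\<phi> h - \<phi> k) * ((2 * c) ^ n * fact n / (2 * pi) * ?I (H - {h, k}))"
      using Suc.prems(3)[of h k] h k by auto
  qed
  also have "\<dots> = c * ((2 * c) ^ n * fact n) / (2 * pi) *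
      (\<Sum>k\<in>H - {h}. cos (\<phi> h - \<phi> k) * ?I (H - {h, k}))"
    by (simp add: sum_distrib_left mult_ac)
  also have "\<dots> = c * ((2 * c) ^ n * fact n) / (2 * pi) * (real (card H) * ?I H)"
    by (simp add: integral_prod_cos_rec[OF Suc.prems(1) h])
  also have "\<dots> = (2 * c) ^ Suc n * fact (Suc n) / (2 * pi) * ?I H"
    by (simp add: Suc.prems(2) field_simps)
  finally show ?case .
qed

section \<open>Laplace's principle\<close>

text \<open>
  The integral is at most \<open>(b - a) * L ^ N\<close>. Conversely, for every \<open>K < L\<close> continuity gives a
  nondegenerate interval around \<open>t0\<close> on which \<open>f \<ge> K\<close>, so the integral is at least \<open>w * K ^ N\<close> with
  \<open>w\<close> the length of that interval. Prefactors do not influence the exponential rate.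
\<close>

lemma ln_integral_power_tendsto:
  fixes f :: "real \<Rightarrow> real"
  assumes "a < b" and cont: "continuous_on {a..b} f"
    and bounds: "\<And>t. t \<in> {a..b} \<Longrightarrow> 0 \<le> f t" "\<And>t. t \<in> {a..b} \<Longrightarrow> f t \<le> L"
    and attained: "t0 \<in> {a..b}" "f t0 = L" and "0 < L"
  shows "\<And>N. 0 < integral {a..b} (\<lambda>t. f t ^ N)"
    and "(\<lambda>N. 1 / real N * ln (integral {a..b} (\<lambda>t. f t ^ N))) \<longlonglongrightarrow> ln L"
proof -
  let ?I = "\<lambda>N. integral {a..b} (\<lambda>t. f t ^ N)"
  have int: "(\<lambda>t. f t ^ N) integrable_on {a..b}" for N
    by (intro integrable_continuous_real continuous_intros cont)
  have lower: "\<exists>w>0. \<forall>N. w * K ^ N \<le> ?I N" if K: "0 < K" "K < L" for K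
  proof -
    obtain d where d: "d > 0" "\<And>t. t \<in> {a..b} \<Longrightarrow> dist t t0 < d \<Longrightarrow> dist (f t) (f t0) < L - K"
      using cont attained K unfolding continuous_on_iff by (metis diff_gt_0_iff_gt)
    obtain u v where uv: "u < v" "{u..v} \<subseteq> {a..b}" "\<And>t. t \<in> {u..v} \<Longrightarrow> dist t t0 < d"
      \<comment> \<open>If \<open>t0\<close> is an endpoint, only one side of it lies in the domain.\<close>
    proof (cases "t0 < b")
      case True
      then show thesis
        using d(1) attained by (intro that[of t0 "min b (t0 + d / 2)"]) (auto simp: dist_real_def)
    next
      case False
      then show thesis
        using d(1) attained \<open>a < b\<close>
        by (intro that[of "max a (t0 - d / 2)" t0]) (auto simp: dist_real_def)
    qed
    have "(v - u) * K ^ N \<le> ?I N" for N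
    proof -
      have int': "(\<lambda>t. f t ^ N) integrable_on {u..v}"
        using integrable_on_subinterval[OF int uv(2)] .
      have "(v - u) * K ^ N = integral {u..v} (\<lambda>t. K ^ N)"
        using uv(1) by simp
      also have "\<dots> \<le> integral {u..v} (\<lambda>t. f t ^ N)"
      proof (rule integral_le[OF _ int'])
        fix t assume t: "t \<in> {u..v}"
        then have "dist (f t) (f t0) < L - K"
          using d(2) uv by blast
        then have "K \<le> f t"
          using attained by (auto simp: dist_real_def)
        then show "K ^ N \<le> f t ^ N"
          using K by (intro power_mono) auto
      qed auto
      also have "\<dots> \<le> ?I N"
        using uv int int' bounds by (intro integral_subset_le) auto
      finally show ?thesis .
    qed
    then show ?thesis
      using uv(1) by (intro exI[of _ "v - u"]) auto
  qed
  show pos: "0 < ?I N" for N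
  proof -
    obtain w where "w > 0" "w * (L / 2) ^ N \<le> ?I N"
      using lower[of "L / 2"] \<open>0 < L\<close> by auto
    moreover have "0 < w * (L / 2) ^ N"
      using \<open>w > 0\<close> \<open>0 < L\<close> by simp
    ultimately show ?thesis by linarith
  qed
  have upper: "?I N \<le> (b - a) * L ^ N" for N
  proof -
    have "?I N \<le> integral {a..b} (\<lambda>t. L ^ N)"
      using bounds by (intro integral_le int power_mono) auto
    then show ?thesis
      using \<open>a < b\<close> by simp
  qed
  have rate: "(\<lambda>N. 1 / real N * ln (w * K ^ N)) \<longlonglongrightarrow> ln K" if "w > 0" "K > 0" for w K :: real
  proof (rule Lim_transform_eventually)
    show "(\<lambda>N. 1 / real N * ln w + ln K) \<longlonglongrightarrow> ln K"
      by (rule tendsto_eq_intros lim_1_over_n refl)+ simp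
    show "\<forall>\<^sub>F N in sequentially. 1 / real N * ln w + ln K = 1 / real N * ln (w * K ^ N)"
      using eventually_gt_at_top[of 0]
      by eventually_elim (use that in \<open>simp add: ln_mult ln_realpow field_simps\<close>)
  qed
  show "(\<lambda>N. 1 / real N * ln (?I N)) \<longlonglongrightarrow> ln L"
  proof (rule order_tendstoI)
    fix y assume "ln L < y"
    with rate[of "b - a" L] have "\<forall>\<^sub>F N in sequentially. 1 / real N * ln ((b - a) * L ^ N) < y"
      using \<open>a < b\<close> \<open>0 < L\<close> by (auto intro: order_tendstoD(2))
    then show "\<forall>\<^sub>F N in sequentially. 1 / real N * ln (?I N) < y"
    proof eventually_elim
      case (elim N)
      have "1 / real N * ln (?I N) \<le> 1 / real N * ln ((b - a) * L ^ N)"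
        using upper[of N] pos[of N] by (intro mult_left_mono) (auto intro!: ln_mono)
      with elim show ?case by linarith
    qed
  next
    fix y assume "y < ln L"
    then obtain z where z: "y < z" "z < ln L"
      using dense by blast
    \<comment> \<open>A level strictly between \<open>exp y\<close> and \<open>L\<close>, so that the rate \<open>ln K\<close> still exceeds \<open>y\<close>.\<close>
    define K where "K = exp z"
    have K: "0 < K" "K < L" "y < ln K"
      using z \<open>0 < L\<close> by (auto simp: K_def exp_less_cancel_iff[symmetric, of z "ln L"])
    obtain w where w: "w > 0" "\<And>N. w * K ^ N \<le> ?I N"
      using lower K by blast
    have "\<forall>\<^sub>F N in sequentially. y < 1 / real N * ln (w * K ^ N)"
      using rate[of w K] w K by (auto intro: order_tendstoD(1))
    then show "\<forall>\<^sub>F N in sequentially. y < 1 / real N * ln (?I N)"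
    proof eventually_elim
      case (elim N)
      have "1 / real N * ln (w * K ^ N) \<le> 1 / real N * ln (?I N)"
        using w(2)[of N] w(1) K(1) by (intro mult_left_mono) (auto intro!: ln_mono)
      with elim show ?case by linarith
    qed
  qed
qed

section \<open>The maximum of the one-vertex factor\<close>

text \<open>
  Cauchy-Schwarz for \<open>(a, b)\<close> and \<open>(cos u, sin u)\<close>, with equality when \<open>(a, b)\<close> points in the direction \<open>u\<close>.
\<close>

lemma linear_trig_max:
  fixes a b R :: real
  assumes "0 < R" and R: "R\<^sup>2 = a\<^sup>2 + b\<^sup>2"
  shows "a * cos u + b * sin u \<le> R"
    and "\<exists>u\<in>{0..2*pi}. a * cos u + b * sin u = R"
proof -
  have "(a * cos u + b * sin u)\<^sup>2 + (a * sin u - b * cos u)\<^sup>2 =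
      (a\<^sup>2 + b\<^sup>2) * ((cos u)\<^sup>2 + (sin u)\<^sup>2)"
    by algebra
  then have "(a * cos u + b * sin u)\<^sup>2 + (a * sin u - b * cos u)\<^sup>2 = R\<^sup>2"
    by (simp add: R)
  then have "(a * cos u + b * sin u)\<^sup>2 \<le> R\<^sup>2"
    using zero_le_power2[of "a * sin u - b * cos u"] by linarith
  then show "a * cos u + b * sin u \<le> R"
    using \<open>0 < R\<close> by (meson less_imp_le power2_le_imp_le)
  have "(a / R)\<^sup>2 + (b / R)\<^sup>2 = 1"
    using \<open>0 < R\<close> by (simp add: power_divide add_divide_distrib[symmetric] flip: R)
  then obtain u where u: "0 \<le> u" "u < 2 * pi" "a / R = cos u" "b / R = sin u"
    using sincos_total_2pi by metis
  have "a * cos u + b * sin u = (a\<^sup>2 + b\<^sup>2) / R"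
    by (simp add: power2_eq_square add_divide_distrib flip: u(3,4))
  also have "\<dots> = R"
    using \<open>0 < R\<close> by (simp only: R[symmetric]) (simp add: power2_eq_square)
  finally show "\<exists>u\<in>{0..2*pi}. a * cos u + b * sin u = R"
    using u(1,2) by (intro bexI[of _ u]) auto
qed

text \<open>
  In the double angle \<open>2 * t\<close> the function is \<open>cosh B\<close> plus a linear trigonometric polynomial of
  amplitude \<open>R\<close>. With \<open>cos (2 * \<phi>) = exp (- 2 * \<beta>)\<close> the maximum becomes \<open>exp (- \<beta>) * \<lambda>\<^sub>+\<close>.
\<close>

lemma cos_square_mixture_max:
  fixes \<phi> B :: real
  defines "F \<equiv> \<lambda>t. exp B * (cos (t - \<phi>))\<^sup>2 + exp (- B) * (cos (t + \<phi>))\<^sup>2"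
  defines "R \<equiv> sqrt ((sinh B)\<^sup>2 + (cos (2 * \<phi>))\<^sup>2)"
  assumes "cos (2 * \<phi>) \<noteq> 0"
  shows "F t \<le> cosh B + R" and "\<exists>t\<in>{0..2*pi}. F t = cosh B + R"
proof -
  have F: "F t = cosh B + (cosh B * cos (2 * \<phi>) * cos (2 * t) + sinh B * sin (2 * \<phi>) * sin (2 * t))"
    for t
  proof -
    have minus: "(cos (t - \<phi>))\<^sup>2 =
        (1 + cos (2 * t) * cos (2 * \<phi>) + sin (2 * t) * sin (2 * \<phi>)) / 2"
      using cos_double_cos[of "t - \<phi>"] cos_diff[of "2 * t" "2 * \<phi>"]
      by (simp add: right_diff_distrib)
    have plus: "(cos (t + \<phi>))\<^sup>2 =
        (1 + cos (2 * t) * cos (2 * \<phi>) - sin (2 * t) * sin (2 * \<phi>)) / 2"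
      using cos_double_cos[of "t + \<phi>"] cos_add[of "2 * t" "2 * \<phi>"]
      by (simp add: distrib_left)
    have linear: "(p + q) * ((1 + x * y + z * w) / 2) + (p - q) * ((1 + x * y - z * w) / 2) =
        p + (p * y * x + q * w * z)" for p q w x y z :: real
      by (simp add: field_simps)
    show ?thesis
      unfolding F_def minus plus cosh_plus_sinh[of B, symmetric] cosh_minus_sinh[of B, symmetric]
      by (rule linear)
  qed
  have R: "0 < R"
    unfolding R_def using assms(3) by (simp add: add_nonneg_pos)
  have "(cosh B * cos (2 * \<phi>))\<^sup>2 + (sinh B * sin (2 * \<phi>))\<^sup>2 =
      (1 + (sinh B)\<^sup>2) * (cos (2 * \<phi>))\<^sup>2 + (sinh B)\<^sup>2 * (1 - (cos (2 * \<phi>))\<^sup>2)"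
    by (simp add: power_mult_distrib cosh_square_eq sin_squared_eq)
  also have "\<dots> = R\<^sup>2"
    by (simp add: R_def algebra_simps)
  finally have R2: "R\<^sup>2 = (cosh B * cos (2 * \<phi>))\<^sup>2 + (sinh B * sin (2 * \<phi>))\<^sup>2" ..
  show "F t \<le> cosh B + R"
    using linear_trig_max(1)[OF R R2, of "2 * t"] by (simp add: F)
  obtain u where u: "u \<in> {0..2*pi}"
      "cosh B * cos (2 * \<phi>) * cos u + sinh B * sin (2 * \<phi>) * sin u = R"
    using linear_trig_max(2)[OF R R2] by blast
  then show "\<exists>t\<in>{0..2*pi}. F t = cosh B + R"
    by (intro bexI[of _ "u / 2"]) (auto simp: F)
qed

section \<open>Convergence of subgradients\<close>

text \<open>
  For \<open>h > 0\<close> the subgradient \<open>m N\<close> is at most the difference quotient of \<open>p N\<close> at step \<open>h\<close>, for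
  \<open>h < 0\<close> it is at least that quotient. The quotients converge to those of \<open>q\<close>, and these are
  arbitrarily close to \<open>D\<close> for small \<open>h\<close>.
\<close>

lemma subgradient_tendsto_derivative:
  fixes p :: "nat \<Rightarrow> real \<Rightarrow> real"
  assumes lim: "\<And>y. (\<lambda>N. p N y) \<longlonglongrightarrow> q y"
    and sub: "\<forall>\<^sub>F N in sequentially. \<forall>h. p N x + h * m N \<le> p N (x + h)"
    and deriv: "(q has_real_derivative D) (at x)"
  shows "m \<longlonglongrightarrow> D"
proof -
  have quot: "((\<lambda>h. (q (x + h) - q x) / h) \<longlongrightarrow> D) (at 0)"
    using deriv by (simp add: DERIV_def)
  have quotN: "(\<lambda>N. (p N (x + h) - p N x) / h) \<longlonglongrightarrow> (q (x + h) - q x) / h" if "h \<noteq> 0" for h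
    by (intro tendsto_intros lim that)
  show ?thesis
  proof (rule order_tendstoI)
    fix y assume "D < y"
    have "\<forall>\<^sub>F h in at_right 0. (q (x + h) - q x) / h < y"
      using order_tendstoD(2)[OF quot \<open>D < y\<close>] by (simp add: eventually_at_split)
    moreover have "\<forall>\<^sub>F h in at_right (0::real). h > 0"
      by (rule eventually_at_right_less)
    ultimately have "\<forall>\<^sub>F h in at_right 0. h > 0 \<and> (q (x + h) - q x) / h < y"
      by eventually_elim simp
    then obtain h where h: "h > 0" "(q (x + h) - q x) / h < y"
      using eventually_happens trivial_limit_at_right_real by blast
    from quotN[of h] h have "\<forall>\<^sub>F N in sequentially. (p N (x + h) - p N x) / h < y"
      by (auto intro: order_tendstoD(2))
    with sub show "\<forall>\<^sub>F N in sequentially. m N < y"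
    proof eventually_elim
      case (elim N)
      have "m N \<le> (p N (x + h) - p N x) / h"
        using elim(1)[rule_format, of h] h(1) by (simp add: field_simps)
      with elim(2) show ?case by linarith
    qed
  next
    fix y assume "y < D"
    have "\<forall>\<^sub>F h in at_left 0. y < (q (x + h) - q x) / h"
      using order_tendstoD(1)[OF quot \<open>y < D\<close>] by (simp add: eventually_at_split)
    moreover have "\<forall>\<^sub>F h in at_left (0::real). h < 0"
      by (simp add: eventually_at_filter)
    ultimately have "\<forall>\<^sub>F h in at_left 0. h < 0 \<and> y < (q (x + h) - q x) / h"
      by eventually_elim simp
    then obtain h where h: "h < 0" "y < (q (x + h) - q x) / h"
      using eventually_happens trivial_limit_at_left_real by blast
    from quotN[of h] h have "\<forall>\<^sub>F N in sequentially. y < (p N (x + h) - p N x) / h"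
      by (auto intro: order_tendstoD(1))
    with sub show "\<forall>\<^sub>F N in sequentially. y < m N"
    proof eventually_elim
      case (elim N)
      have "(p N (x + h) - p N x) / h \<le> m N"
        using elim(1)[rule_format, of h] h(1) by (simp add: field_simps)
      with elim(2) show ?case by linarith
    qed
  qed
qed

text \<open>
  The logarithm of a sum of exponentials lies above its tangent at zero, whose slope is the
  weighted mean \<open>m\<close> of \<open>s\<close>. This is Jensen's inequality, obtained here by averaging
  \<open>exp (h * (s a - m)) \<ge> 1 + h * (s a - m)\<close> against \<open>c\<close>.
\<close>

lemma ln_sum_exp_subgradient:
  fixes c s :: "'a \<Rightarrow> real"
  assumes "finite A" "A \<noteq> {}" and c: "\<And>a. a \<in> A \<Longrightarrow> 0 < c a"
  shows "ln (\<Sum>a\<in>A. c a) + h * ((\<Sum>a\<in>A. s a * c a) / (\<Sum>a\<in>A. c a))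
    \<le> ln (\<Sum>a\<in>A. c a * exp (h * s a))"
proof -
  define Z where "Z = (\<Sum>a\<in>A. c a)"
  define m where "m = (\<Sum>a\<in>A. s a * c a) / Z"
  have Z: "0 < Z"
    unfolding Z_def using assms by (intro sum_pos) auto
  have "Z = (\<Sum>a\<in>A. c a * (1 + h * (s a - m)))"
  proof -
    have "(\<Sum>a\<in>A. c a * (1 + h * (s a - m))) = Z + h * ((\<Sum>a\<in>A. s a * c a) - m * Z)"
      by (simp add: Z_def algebra_simps sum.distrib sum_subtractf sum_distrib_left)
    then show ?thesis
      using Z by (simp add: m_def)
  qed
  also have "\<dots> \<le> (\<Sum>a\<in>A. c a * exp (h * (s a - m)))"
    using c by (intro sum_mono mult_left_mono) (auto intro: less_imp_le)
  also have "\<dots> = exp (- (h * m)) * (\<Sum>a\<in>A. c a * exp (h * s a))"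
    by (simp add: sum_distrib_left right_diff_distrib exp_diff exp_minus field_simps)
  finally have "exp (h * m) * Z \<le> (\<Sum>a\<in>A. c a * exp (h * s a))"
    by (simp add: exp_minus field_simps)
  then have "ln (exp (h * m) * Z) \<le> ln (\<Sum>a\<in>A. c a * exp (h * s a))"
    using Z by (intro ln_mono) auto
  then show ?thesis
    using Z by (simp add: ln_mult Z_def m_def)
qed

section \<open>The magnetization as a subgradient of the pressure\<close>

lemma finite_spins: "finite (spins N)"
  by (auto simp: spins_def intro: finite_PiE)

lemma spins_nonempty: "spins N \<noteq> {}"
  by (auto simp: spins_def PiE_eq_empty_iff)

lemma spin_values: "\<sigma> \<in> spins N \<Longrightarrow> i \<in> {1..N} \<Longrightarrow> \<sigma> i = 1 \<or> \<sigma> i = - 1"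
  by (auto simp: spins_def)

lemma expectation_partition_function:
  assumes "finite (set_pmf Q)"
  shows "measure_pmf.expectation Q (\<lambda>E. partition_function N E \<beta> B) =
    (\<Sum>\<sigma>\<in>spins N. measure_pmf.expectation Q (\<lambda>E. boltzmann_weight N E \<beta> B \<sigma>))"
  unfolding partition_function_def
  by (intro Bochner_Integration.integral_sum integrable_measure_pmf_finite assms)

lemma expectation_boltzmann_weight_pos:
  assumes "finite (set_pmf Q)"
  shows "0 < measure_pmf.expectation Q (\<lambda>E. boltzmann_weight N E \<beta> B \<sigma>)"
proof -
  have "measure_pmf.expectation Q (\<lambda>E. boltzmann_weight N E \<beta> B \<sigma>) =
      (\<Sum>E\<in>set_pmf Q. pmf Q E * boltzmann_weight N E \<beta> B \<sigma>)"
    using assms by (subst integral_measure_pmf[OF assms]) auto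
  also have "\<dots> > 0"
    using assms set_pmf_not_empty[of Q]
    by (intro sum_pos) (auto simp: boltzmann_weight_def pmf_positive)
  finally show ?thesis .
qed

text \<open>
  Changing the field from \<open>B\<close> to \<open>B + h\<close> multiplies the annealed weight of \<open>\<sigma>\<close> by
  \<open>exp (h * total_spin N \<sigma>)\<close>, so \<open>ln_sum_exp_subgradient\<close> applies with \<open>s\<close> the total spin.
\<close>

lemma annealed_pressure_subgradient:
  assumes fin: "finite (set_pmf Q)" and N: "1 \<le> N"
  shows "annealed_pressure Q N \<beta> B + h * annealed_magnetization Q N \<beta> B
    \<le> annealed_pressure Q N \<beta> (B + h)"
proof -
  define c where "c \<sigma> = measure_pmf.expectation Q (\<lambda>E. boltzmann_weight N E \<beta> B \<sigma>)" for \<sigma>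
  have tilt: "measure_pmf.expectation Q (\<lambda>E. boltzmann_weight N E \<beta> (B + h) \<sigma>) =
      c \<sigma> * exp (h * total_spin N \<sigma>)" for \<sigma>
  proof -
    have "boltzmann_weight N E \<beta> (B + h) \<sigma> =
        boltzmann_weight N E \<beta> B \<sigma> * exp (h * total_spin N \<sigma>)" for E
      by (simp add: boltzmann_weight_def algebra_simps flip: exp_add)
    then show ?thesis
      by (simp add: c_def)
  qed
  let ?Z = "\<Sum>\<sigma>\<in>spins N. c \<sigma>"
  let ?m = "(\<Sum>\<sigma>\<in>spins N. total_spin N \<sigma> * c \<sigma>) / ?Z"
  have "ln ?Z + h * ?m \<le> ln (\<Sum>\<sigma>\<in>spins N. c \<sigma> * exp (h * total_spin N \<sigma>))"
    unfolding c_def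
    by (intro ln_sum_exp_subgradient finite_spins spins_nonempty
        expectation_boltzmann_weight_pos fin)
  then have "1 / real N * (ln ?Z + h * ?m) \<le>
      1 / real N * ln (\<Sum>\<sigma>\<in>spins N. c \<sigma> * exp (h * total_spin N \<sigma>))"
    by (intro mult_left_mono) auto
  moreover have "annealed_magnetization Q N \<beta> B = 1 / real N * ?m"
    unfolding annealed_magnetization_def annealed_expectation_def annealed_measure_def
      expectation_partition_function[OF fin] c_def[symmetric]
    by (simp add: sum_divide_distrib mult_ac)
  ultimately show ?thesis
    unfolding annealed_pressure_def expectation_partition_function[OF fin] tilt
    by (simp add: c_def[symmetric] algebra_simps)
qed

section \<open>The annealed partition function of the 2-regular model\<close>

lemma card_half_edges_2: "card (half_edges N (\<lambda>_. 2)) = 2 * N"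
  by (simp add: card_half_edges)

lemma pairings_half_edges_2:
  "finite (pairings (half_edges N (\<lambda>_. 2)))" "pairings (half_edges N (\<lambda>_. 2)) \<noteq> {}"
  by (simp_all add: finite_pairings finite_half_edges pairings_nonempty card_half_edges_2)

lemma finite_set_configuration_model_2:
  "finite (set_pmf (configuration_model N (\<lambda>_. 2)))"
  by (simp add: configuration_model_def pairings_half_edges_2)

lemma expectation_configuration_model_2:
  "measure_pmf.expectation (configuration_model N (\<lambda>_. 2)) f =
    (\<Sum>M\<in>pairings (half_edges N (\<lambda>_. 2)). f (edges_of_pairing M)) /
    real (card (pairings (half_edges N (\<lambda>_. 2))))" for f :: "edges \<Rightarrow> real"
  by (simp add: configuration_model_def integral_pmf_of_set pairings_half_edges_2)

lemma prod_half_edges_2: "(\<Prod>h\<in>half_edges N (\<lambda>_. 2). g (fst h)) = (\<Prod>i\<in>{1..N}. (g i)\<^sup>2)"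
  for g :: "nat \<Rightarrow> real"
proof -
  have "(\<Prod>i\<in>{1..N}. (g i)\<^sup>2) = (\<Prod>i\<in>{1..N}. \<Prod>k<2::nat. g i)"
    by simp
  also have "\<dots> = (\<Prod>h\<in>half_edges N (\<lambda>_. 2). g (fst h))"
    unfolding half_edges_def by (subst prod.Sigma) (auto simp: case_prod_unfold)
  finally show ?thesis ..
qed

lemma boltzmann_weight_edges_of_pairing:
  assumes "M \<in> pairings H" "finite H"
  shows "boltzmann_weight N (edges_of_pairing M) \<beta> B \<sigma> =
    exp (B * total_spin N \<sigma>) * (\<Prod>p\<in>M. exp (\<beta> * (\<Prod>h\<in>p. \<sigma> (fst h))))"
proof -
  have "finite M"
    using assms finite_elements[of H M] by (auto simp: pairings_def)
  have "(\<Sum>e\<in>#edges_of_pairing M. \<Prod>i\<in>#e. \<sigma> i) = (\<Sum>p\<in>M. \<Prod>h\<in>p. \<sigma> (fst h))"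
    by (simp add: edges_of_pairing_def image_mset.compositionality o_def
        sum_unfold_sum_mset prod_unfold_prod_mset)
  then show ?thesis
    using \<open>finite M\<close>
    by (simp add: boltzmann_weight_def exp_add exp_sum sum_distrib_left)
qed

text \<open>
  The choice of \<open>\<phi>\<close> puts an Ising bond into the form of the Wick formula: equal spins have angle
  difference \<open>0\<close>, opposite spins have angle difference \<open>\<plusminus>2 * \<phi>\<close>.
\<close>

lemma exp_spin_product:
  fixes \<beta> \<phi> s s' :: real
  assumes "cos (2 * \<phi>) = exp (- 2 * \<beta>)" "s = 1 \<or> s = - 1" "s' = 1 \<or> s' = - 1"
  shows "exp (\<beta> * (s * s')) = exp \<beta> * cos (s * \<phi> - s' * \<phi>)"
proof -
  have "exp (- \<beta>) = exp \<beta> * exp (- 2 * \<beta>)"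
    by (simp flip: exp_add)
  also have "\<dots> = exp \<beta> * cos (\<phi> + \<phi>)"
    by (simp only: assms(1)[symmetric] mult_2)
  finally have opposite: "exp (- \<beta>) = exp \<beta> * cos (\<phi> + \<phi>)" .
  have "cos (- \<phi> - \<phi>) = cos (\<phi> + \<phi>)"
    using cos_minus[of "\<phi> + \<phi>"] by simp
  with opposite show ?thesis
    using assms(2,3) by (elim disjE) simp_all
qed

text \<open>
  The Wick formula with angle \<open>\<sigma> i * \<phi>\<close> at both half-edges of \<open>i\<close>; hence the squared cosines.
\<close>

lemma sum_pairings_boltzmann_weight:
  assumes \<phi>: "cos (2 * \<phi>) = exp (- 2 * \<beta>)" and \<sigma>: "\<sigma> \<in> spins N"
  shows "(\<Sum>M\<in>pairings (half_edges N (\<lambda>_. 2)). boltzmann_weight N (edges_of_pairing M) \<beta> B \<sigma>) =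
    (2 * exp \<beta>) ^ N * fact N / (2 * pi) *
    integral {0..2*pi} (\<lambda>t. \<Prod>i\<in>{1..N}. exp (B * \<sigma> i) * (cos (t - \<sigma> i * \<phi>))\<^sup>2)"
proof -
  let ?H = "half_edges N (\<lambda>_. 2)"
  have "(\<Sum>M\<in>pairings ?H. boltzmann_weight N (edges_of_pairing M) \<beta> B \<sigma>) =
      exp (B * total_spin N \<sigma>) * (\<Sum>M\<in>pairings ?H. \<Prod>p\<in>M. exp (\<beta> * (\<Prod>h\<in>p. \<sigma> (fst h))))"
    using finite_half_edges[of N "\<lambda>_. 2"]
    by (simp add: boltzmann_weight_edges_of_pairing sum_distrib_left)
  also have "(\<Sum>M\<in>pairings ?H. \<Prod>p\<in>M. exp (\<beta> * (\<Prod>h\<in>p. \<sigma> (fst h)))) =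
      (2 * exp \<beta>) ^ N * fact N / (2 * pi) *
      integral {0..2*pi} (\<lambda>t. \<Prod>h\<in>?H. cos (t - \<sigma> (fst h) * \<phi>))"
  proof (rule sum_pairings_cos[OF finite_half_edges card_half_edges_2])
    fix h k :: "nat \<times> nat" assume *: "h \<in> ?H" "k \<in> ?H" "h \<noteq> k"
    have "\<sigma> (fst x) = 1 \<or> \<sigma> (fst x) = - 1" if "x \<in> ?H" for x
      using that by (intro spin_values[OF \<sigma>]) (auto simp: half_edges_def)
    with * show "exp (\<beta> * (\<Prod>h\<in>{h, k}. \<sigma> (fst h))) =
        exp \<beta> * cos (\<sigma> (fst h) * \<phi> - \<sigma> (fst k) * \<phi>)"
      using exp_spin_product[OF \<phi>] *(3) by simp
  qed
  also have "(\<lambda>t. \<Prod>h\<in>?H. cos (t - \<sigma> (fst h) * \<phi>)) =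
      (\<lambda>t. \<Prod>i\<in>{1..N}. (cos (t - \<sigma> i * \<phi>))\<^sup>2)"
    by (intro ext prod_half_edges_2)
  finally show ?thesis
    by (simp add: prod.distrib total_spin_def exp_sum sum_distrib_left mult_ac)
qed

text \<open>
  Counting pairings by the same formula, with all angles zero, keeps the normalisation in the same
  form as the weighted sum: the constants cancel in the quotient, and Laplace's principle applies to numerator and
  denominator alike.
\<close>

lemma card_pairings_half_edges_2:
  "real (card (pairings (half_edges N (\<lambda>_. 2)))) =
    2 ^ N * fact N / (2 * pi) * integral {0..2*pi} (\<lambda>t. ((cos t)\<^sup>2) ^ N)"
proof -
  let ?H = "half_edges N (\<lambda>_. 2)"
  have "real (card (pairings ?H)) = (\<Sum>M\<in>pairings ?H. \<Prod>p\<in>M. 1)"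
    by simp
  also have "\<dots> = (2 * 1) ^ N * fact N / (2 * pi) * integral {0..2*pi} (\<lambda>t. \<Prod>h\<in>?H. cos (t - 0))"
    by (rule sum_pairings_cos[OF finite_half_edges card_half_edges_2]) simp
  also have "(\<lambda>t::real. \<Prod>h\<in>?H. cos (t - 0)) = (\<lambda>t. ((cos t)\<^sup>2) ^ N)"
    using prod_half_edges_2[where g = "\<lambda>_. cos _"] by (intro ext) simp
  finally show ?thesis by simp
qed

text \<open>
  Inside the integral the spins at different vertices are independent, so that summing over
  configurations amounts to summing over the two spins at each vertex separately.
\<close>

lemma expectation_partition_function_CM_2:
  assumes \<phi>: "cos (2 * \<phi>) = exp (- 2 * \<beta>)"
  shows "measure_pmf.expectation (configuration_model N (\<lambda>_. 2)) (\<lambda>E. partition_function N E \<beta> B) =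
    exp \<beta> ^ N *
    integral {0..2*pi} (\<lambda>t. (exp B * (cos (t - \<phi>))\<^sup>2 + exp (- B) * (cos (t + \<phi>))\<^sup>2) ^ N) /
    integral {0..2*pi} (\<lambda>t. ((cos t)\<^sup>2) ^ N)"
proof -
  let ?P = "pairings (half_edges N (\<lambda>_. 2))"
  let ?f = "\<lambda>s t. exp (B * s) * (cos (t - s * \<phi>))\<^sup>2"
  have "(\<Sum>M\<in>?P. partition_function N (edges_of_pairing M) \<beta> B) =
      (\<Sum>\<sigma>\<in>spins N. \<Sum>M\<in>?P. boltzmann_weight N (edges_of_pairing M) \<beta> B \<sigma>)"
    unfolding partition_function_def by (rule sum.swap)
  also have "\<dots> = (2 * exp \<beta>) ^ N * fact N / (2 * pi) *
      (\<Sum>\<sigma>\<in>spins N. integral {0..2*pi} (\<lambda>t. \<Prod>i\<in>{1..N}. ?f (\<sigma> i) t))"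
    by (simp add: sum_pairings_boltzmann_weight[OF \<phi>] sum_distrib_left)
  also have "(\<Sum>\<sigma>\<in>spins N. integral {0..2*pi} (\<lambda>t. \<Prod>i\<in>{1..N}. ?f (\<sigma> i) t)) =
      integral {0..2*pi} (\<lambda>t. \<Sum>\<sigma>\<in>spins N. \<Prod>i\<in>{1..N}. ?f (\<sigma> i) t)"
    by (intro integral_sum[symmetric] finite_spins integrable_continuous_real continuous_intros)
  also have "(\<lambda>t. \<Sum>\<sigma>\<in>spins N. \<Prod>i\<in>{1..N}. ?f (\<sigma> i) t) =
      (\<lambda>t. (exp B * (cos (t - \<phi>))\<^sup>2 + exp (- B) * (cos (t + \<phi>))\<^sup>2) ^ N)"
  proof
    fix t
    have "(\<Sum>\<sigma>\<in>spins N. \<Prod>i\<in>{1..N}. ?f (\<sigma> i) t) = (\<Prod>i\<in>{1..N}. \<Sum>s\<in>{-1, 1}. ?f s t)"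
      unfolding spins_def by (rule prod_sum_PiE[symmetric]) auto
    then show "(\<Sum>\<sigma>\<in>spins N. \<Prod>i\<in>{1..N}. ?f (\<sigma> i) t) =
        (exp B * (cos (t - \<phi>))\<^sup>2 + exp (- B) * (cos (t + \<phi>))\<^sup>2) ^ N"
      by (simp add: add.commute)
  qed
  finally show ?thesis
    by (simp add: expectation_configuration_model_2 card_pairings_half_edges_2 power_mult_distrib)
qed

section \<open>The thermodynamic limit\<close>

lemma annealed_pressure_tendsto:
  fixes \<beta> B :: real
  assumes "0 \<le> \<beta>"
  shows "(\<lambda>N. annealed_pressure (configuration_model N (\<lambda>_. 2)) N \<beta> B)
    \<longlonglongrightarrow> ln (lambda_plus \<beta> B)"
proof -
  define \<phi> where "\<phi> = arccos (exp (- 2 * \<beta>)) / 2"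
  have \<phi>: "cos (2 * \<phi>) = exp (- 2 * \<beta>)"
  proof -
    have "exp (- 2 * \<beta>) \<le> 1"
      using assms by simp
    moreover have "- 1 \<le> exp (- 2 * \<beta>)"
      using exp_gt_zero[of "- 2 * \<beta>"] by linarith
    ultimately show ?thesis
      by (simp add: \<phi>_def)
  qed
  define F where "F t = exp B * (cos (t - \<phi>))\<^sup>2 + exp (- B) * (cos (t + \<phi>))\<^sup>2" for t
  define L where "L = cosh B + sqrt ((sinh B)\<^sup>2 + (cos (2 * \<phi>))\<^sup>2)"
  have max: "F t \<le> L" "\<exists>t\<in>{0..2*pi}. F t = L" for t
    using cos_square_mixture_max[of \<phi> B] \<phi> unfolding F_def L_def by auto
  have "0 < L"
    unfolding L_def by (intro add_pos_nonneg) auto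
  obtain t0 where t0: "t0 \<in> {0..2*pi}" "F t0 = L"
    using max(2) by blast
  have contF: "continuous_on {0..2*pi} F"
    unfolding F_def by (intro continuous_intros)
  have F_nonneg: "0 \<le> F t" for t
    by (simp add: F_def)
  have cont_cos: "continuous_on {0..2*pi} (\<lambda>t::real. (cos t)\<^sup>2)"
    by (intro continuous_intros)
  have cos_le: "(cos t)\<^sup>2 \<le> 1" for t :: real
    by (simp add: abs_square_le_1)
  have period: "0 < 2 * pi" "0 \<in> {0..2*pi}"
    by auto
  note F_lim = ln_integral_power_tendsto[OF period(1) contF F_nonneg max(1) t0 \<open>0 < L\<close>]
  note cos_lim = ln_integral_power_tendsto[OF period(1) cont_cos zero_le_power2 cos_le period(2)]
  have "(\<lambda>N. \<beta> + 1 / real N * ln (integral {0..2*pi} (\<lambda>t. F t ^ N))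
      - 1 / real N * ln (integral {0..2*pi} (\<lambda>t. ((cos t)\<^sup>2) ^ N))) \<longlonglongrightarrow> \<beta> + ln L - ln 1"
    by (intro tendsto_diff tendsto_add tendsto_const F_lim(2) cos_lim(2)) auto
  moreover have "\<beta> + ln L - ln 1 = ln (lambda_plus \<beta> B)"
  proof -
    have "(cos (2 * \<phi>))\<^sup>2 = exp (- 4 * \<beta>)"
      by (simp add: \<phi> power2_eq_square flip: exp_add)
    then have "lambda_plus \<beta> B = exp \<beta> * L"
      unfolding lambda_plus_def L_def by simp
    with \<open>0 < L\<close> show ?thesis
      by (simp add: ln_mult)
  qed
  moreover have "\<forall>\<^sub>F N in sequentially.
      \<beta> + 1 / real N * ln (integral {0..2*pi} (\<lambda>t. F t ^ N))
        - 1 / real N * ln (integral {0..2*pi} (\<lambda>t. ((cos t)\<^sup>2) ^ N))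
      = annealed_pressure (configuration_model N (\<lambda>_. 2)) N \<beta> B"
    using eventually_gt_at_top[of 0]
  proof eventually_elim
    case (elim N)
    have "0 < integral {0..2*pi} (\<lambda>t. F t ^ N)"
      using F_lim(1) by simp
    moreover have "0 < integral {0..2*pi} (\<lambda>t::real. ((cos t)\<^sup>2) ^ N)"
      using cos_lim(1) by simp
    ultimately show ?case
      using elim unfolding annealed_pressure_def expectation_partition_function_CM_2[OF \<phi>] F_def[symmetric]
      by (simp add: ln_mult ln_div ln_realpow field_simps)
  qed
  ultimately show ?thesis
    by (auto elim: Lim_transform_eventually)
qed

lemma ln_lambda_plus_has_derivative:
  "((\<lambda>B. ln (lambda_plus \<beta> B)) has_real_derivative
     sinh B / sqrt ((sinh B)\<^sup>2 + exp (- 4 * \<beta>))) (at B)"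
proof -
  define R where "R = sqrt ((sinh B)\<^sup>2 + exp (- 4 * \<beta>))"
  have pos: "0 < (sinh B)\<^sup>2 + exp (- 4 * \<beta>)" for B
    by (intro add_nonneg_pos) auto
  have R: "0 < R"
    using pos[of B] by (simp add: R_def)
  have L: "0 < cosh B + R"
    using R cosh_real_pos[of B] by linarith
  have lam: "lambda_plus \<beta> B = exp \<beta> * (cosh B + R)"
    by (simp add: lambda_plus_def R_def)
  then have "0 < lambda_plus \<beta> B"
    using L by simp
  moreover have "(lambda_plus \<beta> has_real_derivative exp \<beta> * (sinh B + sinh B * cosh B / R)) (at B)"
  proof -
    have "((\<lambda>B. (sinh B)\<^sup>2 + exp (- 4 * \<beta>)) has_real_derivative 2 * sinh B * cosh B) (at B)"
      by (auto intro!: derivative_eq_intros)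
    then have "((\<lambda>B. sqrt ((sinh B)\<^sup>2 + exp (- 4 * \<beta>))) has_real_derivative
        inverse R / 2 * (2 * sinh B * cosh B)) (at B)"
      unfolding R_def by (rule DERIV_chain2[where f = sqrt, rotated]) (rule DERIV_real_sqrt[OF pos])
    moreover have "inverse R / 2 * (2 * sinh B * cosh B) = sinh B * cosh B / R"
      by (simp add: field_simps)
    ultimately have "((\<lambda>B. sqrt ((sinh B)\<^sup>2 + exp (- 4 * \<beta>))) has_real_derivative
        sinh B * cosh B / R) (at B)"
      by simp
    moreover have "(cosh has_real_derivative sinh B) (at B)"
      by (auto intro!: derivative_eq_intros)
    ultimately show ?thesis
      unfolding lambda_plus_def by (intro DERIV_cmult DERIV_add)
  qed
  ultimately have "((\<lambda>B. ln (lambda_plus \<beta> B)) has_real_derivative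
      1 / lambda_plus \<beta> B * (exp \<beta> * (sinh B + sinh B * cosh B / R))) (at B)"
    by (intro DERIV_chain2[where f = ln and g = "lambda_plus \<beta>"] DERIV_ln_divide)
  moreover have "1 / lambda_plus \<beta> B * (exp \<beta> * (sinh B + sinh B * cosh B / R)) = sinh B / R"
  proof -
    have "sinh B + sinh B * cosh B / R = sinh B / R * (cosh B + R)"
      using R by (simp add: field_simps)
    then show ?thesis
      using L by (simp add: lam)
  qed
  ultimately show ?thesis
    by (simp add: R_def)
qed

theorem theorem1p4:
  fixes Q :: "nat \<Rightarrow> edges pmf" and \<beta> B :: real
  assumes Q: "\<And>N. N \<ge> 1 \<Longrightarrow> Q N = configuration_model N (\<lambda>_. 2)"
    and beta: "\<beta> > 0"
  shows "((\<lambda>N. annealed_pressure (Q N) N \<beta> B) \<longlonglongrightarrow> ln (lambda_plus \<beta> B)) \<and>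
         ((\<lambda>N. annealed_magnetization (Q N) N \<beta> B) \<longlonglongrightarrow>
            sinh B / sqrt ((sinh B)\<^sup>2 + exp (- 4 * \<beta>)))"
proof -
  have pressure: "(\<lambda>N. annealed_pressure (Q N) N \<beta> B') \<longlonglongrightarrow> ln (lambda_plus \<beta> B')" for B'
  proof (rule Lim_transform_eventually)
    show "(\<lambda>N. annealed_pressure (configuration_model N (\<lambda>_. 2)) N \<beta> B')
        \<longlonglongrightarrow> ln (lambda_plus \<beta> B')"
      using beta by (intro annealed_pressure_tendsto) simp
    show "\<forall>\<^sub>F N in sequentially. annealed_pressure (configuration_model N (\<lambda>_. 2)) N \<beta> B' =
        annealed_pressure (Q N) N \<beta> B'"
      using eventually_ge_at_top[of 1] by eventually_elim (simp add: Q)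
  qed
  have "\<forall>\<^sub>F N in sequentially. \<forall>h. annealed_pressure (Q N) N \<beta> B
      + h * annealed_magnetization (Q N) N \<beta> B \<le> annealed_pressure (Q N) N \<beta> (B + h)"
    using eventually_ge_at_top[of 1]
  proof eventually_elim
    case (elim N)
    show ?case
      unfolding Q[OF elim]
      by (intro allI annealed_pressure_subgradient finite_set_configuration_model_2 elim)
  qed
  then have "(\<lambda>N. annealed_magnetization (Q N) N \<beta> B) \<longlonglongrightarrow>
      sinh B / sqrt ((sinh B)\<^sup>2 + exp (- 4 * \<beta>))"
    by (rule subgradient_tendsto_derivative[OF pressure _ ln_lambda_plus_has_derivative])
  with pressure show ?thesis by blast
qed

end
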